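(* Let $k\in\mathbb{Z}$, let $n\ge 1$ be an integer, and let $\lambda\in\mathbb{C}$ be nonzero. Then $$\beta_{n,\lambda}^{(k)}-\beta_{n,\lambda}^{(k)}(-1)=\sum_{l=1}^{n}\sum_{m=0}^{l-1}\frac{m!\,(-1)^{l-m-1}\lambda^{n-l}S_{2}(l,m+1)S_{1}(n,l)}{(m+1)^{k-1}}.$$
   Context: For $k\in\mathbb{Z}$, the polylogarithm is the power series $\mathrm{Li}_k(u)=\sum_{n=1}^{\infty}\frac{u^n}{n^k}$. For nonzero $\lambda$, the fully degenerate poly-Bernoulli polynomials $\beta_{n,\lambda}^{(k)}(x)$ are defined by the generating function (identity of formal power series in $t$) $$\frac{\mathrm{Li}_{k}\left(1-(1+\lambda t)^{-1/\lambda}\right)}{1-(1+\lambda t)^{-1/\lambda}}(1+\lambda t)^{x/\lambda}=\sum_{n=0}^{\infty}\beta_{n,\lambda}^{(k)}(x)\frac{t^{n}}{n!},$$ where $(1+\lambda t)^{a}=\sum_{j\ge0}(a)_j\lambda^j\frac{t^j}{j!}$, $(a)_j=a(a-1)\cdots(a-j+1)$ with $(a)_0=1$, and $\mathrm{Li}_k(u)/u$ denotes the series $\sum_{m\ge 0}u^m/(m+1)^k$. The fully degenerate poly-Bernoulli numbers are $\beta_{n,\lambda}^{(k)}=\beta_{n,\lambda}^{(k)}(0)$. $S_1(n,l)$ denotes the (signed) Stirling numbers of the first kind, $(x)_n=\sum_{l=0}^n S_1(n,l)x^l$, and $S_2(n,l)$ the Stirling numbers of the second kind, $\frac{(e^t-1)^l}{l!}=\sum_{n\ge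 l}S_2(n,l)\frac{t^n}{n!}$. *)

theory Defs
  imports
    Complex_Main
    "HOL-Computational_Algebra.Polynomial"
    "HOL-Computational_Algebra.Formal_Power_Series"
    "HOL-Combinatorics.Stirling"
begin

definition fps_polylog :: "int \<Rightarrow> complex fps" where
  "fps_polylog k = Abs_fps (\<lambda>n. if n = 0 then 0 else 1 / of_nat n powi k)"

text \<open>
  The series \<open>Li\<^sub>k(u) / u\<close>, that is, \<open>\<Sum>m\<ge>0. u^m / (m + 1)^k\<close>.
\<close>
definition fps_polylog_div :: "int \<Rightarrow> complex fps" where
  "fps_polylog_div k = fps_shift 1 (fps_polylog k)"

lemma fps_nth_polylog_div:
  "fps_nth (fps_polylog_div k) m = 1 / of_nat (m + 1) powi k"
  by (simp add: fps_polylog_div_def fps_polylog_def)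

lemma fps_polylog_div_times_X: "fps_polylog_div k * fps_X = fps_polylog k"
  by (rule fps_ext) (simp add: fps_polylog_div_def fps_polylog_def)

text \<open>
  The binomial series \<open>(1 + lam t)^a\<close> in \<open>t\<close>; here \<open>a gchoose j\<close> is the falling
  factorial \<open>a (a - 1) \<dots> (a - j + 1)\<close> divided by \<open>j!\<close>.
\<close>
definition fps_degen_power :: "complex \<Rightarrow> complex \<Rightarrow> complex fps" where
  "fps_degen_power lam a = Abs_fps (\<lambda>j. (a gchoose j) * lam ^ j)"

lemma fps_nth_degen_power:
  "fps_nth (fps_degen_power lam a) j = (\<Prod>i<j. a - of_nat i) * lam ^ j / fact j"
  by (simp add: fps_degen_power_def gbinomial_prod_rev atLeast0LessThan)

definition degen_poly_bernoulli_fps :: "int \<Rightarrow> complex \<Rightarrow> complex \<Rightarrow> complex fps" where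
  "degen_poly_bernoulli_fps k lam x =
     (fps_polylog_div k oo (1 - fps_degen_power lam (- (1 / lam)))) * fps_degen_power lam (x / lam)"

text \<open>
  The composition above is meaningful because the inner series has constant term \<open>0\<close>.
\<close>
lemma fps_nth_0_degen_power: "fps_nth (1 - fps_degen_power lam a) 0 = 0"
  by (simp add: fps_degen_power_def)

text \<open>
  Fully degenerate poly-Bernoulli polynomials; only meaningful for \<open>lam \<noteq> 0\<close>.
\<close>
definition degen_poly_bernoulli_poly :: "int \<Rightarrow> complex \<Rightarrow> nat \<Rightarrow> complex \<Rightarrow> complex" where
  "degen_poly_bernoulli_poly k lam n x = fact n * fps_nth (degen_poly_bernoulli_fps k lam x) n"

definition degen_poly_bernoulli :: "int \<Rightarrow> complex \<Rightarrow> nat \<Rightarrow> complex" where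
  "degen_poly_bernoulli k lam n = degen_poly_bernoulli_poly k lam n 0"

lemma degen_poly_bernoulli_fps_eq:
  "degen_poly_bernoulli_fps k lam x =
     Abs_fps (\<lambda>n. degen_poly_bernoulli_poly k lam n x / fact n)"
  by (rule fps_ext) (simp add: degen_poly_bernoulli_poly_def)

text \<open>
  Signed Stirling numbers of the first kind: the coefficients of the falling factorial
  \<open>x (x - 1) \<dots> (x - n + 1)\<close>. The library constant \<^const>\<open>stirling\<close> is the unsigned version.
\<close>
definition stirling_signed :: "nat \<Rightarrow> nat \<Rightarrow> int" where
  "stirling_signed n l = coeff (\<Prod>i<n. [:- of_nat i, 1:]) l"

lemma degree_falling_factorial_poly: "degree (\<Prod>i<n. [:- of_nat i, 1::int:]) = n"
  by (subst degree_prod_eq_sum_degree) auto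

lemma falling_factorial_eq_sum_stirling_signed:
  "(\<Prod>i<n. x - of_nat i) = (\<Sum>l\<le>n. stirling_signed n l * x ^ l)"
proof -
  have "(\<Prod>i<n. x - of_nat i) = poly (\<Prod>i<n. [:- of_nat i, 1:]) x"
    by (simp add: poly_prod)
  also have "\<dots> = (\<Sum>l\<le>n. stirling_signed n l * x ^ l)"
    unfolding poly_altdef degree_falling_factorial_poly stirling_signed_def ..
  finally show ?thesis .
qed

text \<open>
  The library numbers \<^const>\<open>Stirling\<close> of the second kind have the usual exponential
  generating function.
\<close>
lemma Stirling_egf:
  "fps_const (1 / fact l) * (fps_exp 1 - 1) ^ l =
     Abs_fps (\<lambda>n. of_nat (Stirling n l) / fact n :: complex)"
proof (induction l)
  case 0
  have "Stirling n 0 = (if n = 0 then 1 else 0)" for n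
    by (cases n) auto
  then show ?case by (intro fps_ext) simp
next
  case (Suc l)
  note IH_l = Suc.IH
  define F where "F = (\<lambda>l. fps_const (1 / fact l) * (fps_exp 1 - 1) ^ l :: complex fps)"
  have F_deriv: "fps_deriv (F (Suc l)) = fps_const (of_nat (Suc l)) * F (Suc l) + F l"
  proof -
    have c: "fps_const (1 / fact (Suc l)) * fps_const (of_nat (Suc l)) = fps_const (1 / fact l :: complex)"
      by (simp add: field_simps del: of_nat_Suc)
    have "fps_deriv (F (Suc l)) =
        (fps_const (1 / fact (Suc l)) * fps_const (of_nat (Suc l))) * (fps_exp 1 - 1) ^ l * fps_exp 1"
      by (simp add: F_def fps_deriv_power fps_of_nat mult_ac del: of_nat_Suc fact_Suc power_Suc fps_const_mult)
    also have "\<dots> = (fps_const (1 / fact (Suc l)) * fps_const (of_nat (Suc l))) * (fps_exp 1 - 1) ^ Suc l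
        + (fps_const (1 / fact (Suc l)) * fps_const (of_nat (Suc l))) * (fps_exp 1 - 1) ^ l"
      by (simp add: algebra_simps del: of_nat_Suc fact_Suc)
    also have "\<dots> = fps_const (of_nat (Suc l)) * F (Suc l) + F l"
      unfolding c F_def using c by (simp add: mult_ac del: of_nat_Suc fact_Suc power_Suc)
    finally show ?thesis .
  qed
  have "fps_nth (F (Suc l)) n = of_nat (Stirling n (Suc l)) / fact n" for n
  proof (induction n)
    case 0
    show ?case by (simp add: F_def)
  next
    case (Suc n)
    have "of_nat (Suc n) * fps_nth (F (Suc l)) (Suc n) = fps_nth (fps_deriv (F (Suc l))) n"
      by simp
    also have "\<dots> = of_nat (Suc l) * fps_nth (F (Suc l)) n + fps_nth (F l) n"
      unfolding F_deriv by (simp del: of_nat_Suc)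
    also have "fps_nth (F l) n = of_nat (Stirling n l) / fact n"
      using IH_l by (simp add: F_def)
    finally show ?case
      using Suc.IH by (simp add: field_simps del: of_nat_Suc) (simp add: algebra_simps)
  qed
  then show ?case by (intro fps_ext) (simp add: F_def)
qed

end

theory Submission
  imports Defs
begin

text \<open>
  Put \<open>w = (1 + \<lambda>t)\<^bsup>-1/\<lambda>\<^esup>\<close>. The factor \<open>1 - w\<close> produced by the difference of the values at \<open>0\<close>
  and \<open>-1\<close> cancels the denominator, leaving \<open>Li\<^sub>k(1 - w)\<close>, a combination of the powers
  \<open>(1 - w)\<^sup>M\<close>. Expanding binomially, \<open>w\<^sup>j = (1 + \<lambda>t)\<^bsup>-j/\<lambda>\<^esup>\<close> has as coefficients falling factorials,
  which yield \<open>S\<^sub>1(n, l)\<close> times \<open>(-j)\<^sup>l\<close>; the alternating binomial sum of \<open>(-j)\<^sup>l\<close> over \<open>j\<close>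
  is \<open>S\<^sub>2(l, M)\<close> up to sign and a factor \<open>M!\<close>.
\<close>

text \<open>Multiplying by \<open>x - n\<close> gives the recurrence
  \<open>c(n+1, l) = c(n, l-1) - n * c(n, l)\<close> over every ring, so the integer coefficients
  carry over to complex arguments.\<close>

lemma coeff_falling_factorial_poly:
  "coeff (\<Prod>i<n. [:- of_nat i, 1 :: 'a :: comm_ring_1:]) l = of_int (stirling_signed n l)"
proof (induction n arbitrary: l)
  case 0
  show ?case
    by (simp add: stirling_signed_def)
next
  case (Suc n)
  show ?case
    using Suc.IH by (cases l) (simp_all add: stirling_signed_def coeff_pCons)
qed

lemma falling_factorial_eq_sum_of_int_stirling_signed:
  fixes x :: "'a :: idom"
  shows "(\<Prod>i<n. x - of_nat i) = (\<Sum>l\<le>n. of_int (stirling_signed n l) * x ^ l)"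
proof -
  have "degree (\<Prod>i<n. [:- of_nat i, 1 :: 'a:]) = n"
    by (subst degree_prod_eq_sum_degree) auto
  then have "poly (\<Prod>i<n. [:- of_nat i, 1:]) x = (\<Sum>l\<le>n. of_int (stirling_signed n l) * x ^ l)"
    by (simp add: poly_altdef coeff_falling_factorial_poly)
  then show ?thesis
    by (simp add: poly_prod)
qed

lemma fps_degen_power_0: "fps_degen_power lam 0 = 1"
  by (rule fps_ext) (simp add: fps_degen_power_def gbinomial_0_left)

text \<open>Substituting \<open>lam * t\<close> into the ordinary binomial series lets its power law
  transfer through composition.\<close>

lemma fps_degen_power_compose:
  "fps_degen_power lam a = fps_binomial a oo (fps_const lam * fps_X)"
  by (simp add: fps_degen_power_def fps_compose_linear fps_eq_iff)

lemma fps_degen_power_power: "fps_degen_power lam a ^ j = fps_degen_power lam (of_nat j * a)"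
  by (simp add: fps_degen_power_compose fps_compose_power fps_binomial_power)

text \<open>Since \<open>l \<le> n\<close>, the factor \<open>lam ^ n\<close> absorbs the
  denominator of \<open>(a / lam) ^ l\<close> and leaves \<open>lam ^ (n - l)\<close>.\<close>

lemma fps_nth_degen_power_stirling:
  assumes "lam \<noteq> 0"
  shows "fact n * fps_nth (fps_degen_power lam (a / lam)) n =
    (\<Sum>l\<le>n. of_int (stirling_signed n l) * lam ^ (n - l) * a ^ l)"
proof -
  have "fact n * fps_nth (fps_degen_power lam (a / lam)) n =
      (\<Sum>l\<le>n. of_int (stirling_signed n l) * (a / lam) ^ l) * lam ^ n"
    by (simp add: fps_nth_degen_power falling_factorial_eq_sum_of_int_stirling_signed)
  also have "\<dots> = (\<Sum>l\<le>n. of_int (stirling_signed n l) * lam ^ (n - l) * a ^ l)"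
    unfolding sum_distrib_right
    by (rule sum.cong) (use assms in \<open>auto simp: power_diff power_divide\<close>)
  finally show ?thesis .
qed

lemma one_minus_power_expand:
  fixes x :: "'a :: comm_ring_1"
  shows "(1 - x) ^ M = (\<Sum>j\<le>M. of_nat (M choose j) * (- 1) ^ j * x ^ j)"
  using binomial_ring[of "- x" 1 M]
  by (simp add: power_minus[of x] mult.assoc)

text \<open>Both sides are \<open>l!\<close> times the coefficient of \<open>t^l\<close> in
  \<open>(1 - e^t)^M\<close>: one by binomial expansion, the other by the generating function of
  \<open>Stirling\<close>.\<close>

lemma alternating_binomial_power_sum:
  "(\<Sum>j\<le>M. of_nat (M choose j) * (- 1) ^ j * of_nat j ^ l) =
     (- 1) ^ M * fact M * (of_nat (Stirling l M) :: complex)"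
proof -
  have "fps_nth ((fps_exp 1 - 1 :: complex fps) ^ M) l = fact M * of_nat (Stirling l M) / fact l"
    using arg_cong[OF Stirling_egf[of M], of "\<lambda>f. fps_nth f l"] by (simp add: field_simps)
  moreover have "(1 - fps_exp 1 :: complex fps) ^ M = fps_const ((- 1) ^ M) * (fps_exp 1 - 1) ^ M"
    by (metis fps_const_1_eq_1 fps_const_neg fps_const_power minus_diff_eq mult_minus1 power_mult_distrib)
  moreover have "fps_nth ((1 - fps_exp 1) ^ M) l =
      (\<Sum>j\<le>M. of_nat (M choose j) * (- 1) ^ j * of_nat j ^ l :: complex) / fact l"
    unfolding one_minus_power_expand fps_sum_nth sum_divide_distrib
  proof (rule sum.cong)
    fix j
    have "of_nat (M choose j) * (- 1) ^ j = fps_const (of_nat (M choose j) * (- 1) ^ j :: complex)"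
      by (simp add: fps_of_nat flip: fps_const_mult fps_const_power fps_const_neg)
    then show "fps_nth (of_nat (M choose j) * (- 1) ^ j * fps_exp 1 ^ j) l =
        of_nat (M choose j) * (- 1) ^ j * of_nat j ^ l / (fact l :: complex)"
      by (simp add: fps_exp_power_mult)
  qed simp
  ultimately show ?thesis
    by (simp add: mult.assoc)
qed

text \<open>The sign \<open>(-1) ^ (l + M)\<close> collects \<open>(-1) ^ l\<close> from
  \<open>(-j) ^ l\<close> and \<open>(-1) ^ M\<close> from the alternating binomial sum.\<close>

lemma fps_nth_one_minus_degen_power_power:
  assumes "lam \<noteq> 0"
  shows "fact n * fps_nth ((1 - fps_degen_power lam (- (1 / lam))) ^ M) n =
    (\<Sum>l\<le>n. of_int (stirling_signed n l) * lam ^ (n - l)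
       * ((- 1) ^ (l + M) * fact M * of_nat (Stirling l M)))"
proof -
  let ?c = "\<lambda>j. of_nat (M choose j) * (- 1) ^ j :: complex"
  have "fact n * fps_nth ((1 - fps_degen_power lam (- (1 / lam))) ^ M) n =
      (\<Sum>j\<le>M. ?c j * (fact n * fps_nth (fps_degen_power lam (- of_nat j / lam)) n))"
    unfolding one_minus_power_expand fps_sum_nth sum_distrib_left
  proof (rule sum.cong)
    fix j
    have "of_nat (M choose j) * (- 1) ^ j = fps_const (?c j)"
      by (simp add: fps_of_nat flip: fps_const_mult fps_const_power fps_const_neg)
    then show "fact n * fps_nth (of_nat (M choose j) * (- 1) ^ j * fps_degen_power lam (- (1 / lam)) ^ j) n =
        ?c j * (fact n * fps_nth (fps_degen_power lam (- of_nat j / lam)) n)"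
      by (simp add: fps_degen_power_power)
  qed simp
  also have "\<dots> = (\<Sum>j\<le>M. \<Sum>l\<le>n. of_int (stirling_signed n l) * lam ^ (n - l)
      * ((- 1) ^ l * (?c j * of_nat j ^ l)))"
    unfolding fps_nth_degen_power_stirling[OF assms] sum_distrib_left
    by (intro sum.cong refl) (simp add: power_minus[of "of_nat _"])
  also have "\<dots> = (\<Sum>l\<le>n. of_int (stirling_signed n l) * lam ^ (n - l)
      * ((- 1) ^ l * (\<Sum>j\<le>M. ?c j * of_nat j ^ l)))"
    by (subst sum.swap) (simp add: sum_distrib_left)
  finally show ?thesis
    unfolding alternating_binomial_power_sum by (simp add: power_add mult.assoc)
qed

lemma degen_poly_bernoulli_diff_eq_polylog:
  "degen_poly_bernoulli k lam n - degen_poly_bernoulli_poly k lam n (- 1) =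
     fact n * fps_nth (fps_polylog k oo (1 - fps_degen_power lam (- (1 / lam)))) n"
proof -
  let ?u = "1 - fps_degen_power lam (- (1 / lam))"
  have "fps_polylog k oo ?u = (fps_polylog_div k oo ?u) * ?u"
    by (simp only: fps_polylog_div_times_X[symmetric] fps_nth_0_degen_power
        fps_compose_mult_distrib fps_X_fps_compose_startby0)
  \<comment> \<open>The factor \<open>(1 + lam t)^(x / lam)\<close> is \<open>1\<close> at
    \<open>x = 0\<close> and the series subtracted in \<open>?u\<close> at
    \<open>x = -1\<close>.\<close>
  also have "\<dots> = degen_poly_bernoulli_fps k lam 0 - degen_poly_bernoulli_fps k lam (- 1)"
    by (simp add: degen_poly_bernoulli_fps_def fps_degen_power_0 algebra_simps)
  finally show ?thesis
    by (simp add: degen_poly_bernoulli_def degen_poly_bernoulli_poly_def right_diff_distrib)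
qed

theorem theorem2:
  fixes k :: int and n :: nat and lam :: complex
  assumes "n \<ge> 1" and "lam \<noteq> 0"
  shows "degen_poly_bernoulli k lam n - degen_poly_bernoulli_poly k lam n (- 1) =
    (\<Sum>l=1..n. \<Sum>m=0..l - 1.
      fact m * (- 1) ^ (l - m - 1) * lam ^ (n - l)
        * of_nat (Stirling l (m + 1)) * of_int (stirling_signed n l)
        / of_nat (m + 1) powi (k - 1))"
proof -
  let ?u = "1 - fps_degen_power lam (- (1 / lam))"
  let ?T = "\<lambda>M l. 1 / of_nat M powi k * (of_int (stirling_signed n l) * lam ^ (n - l)
      * ((- 1) ^ (l + M) * fact M * of_nat (Stirling l M)))"
  have "fact n * fps_nth (fps_polylog k oo ?u) n =
      (\<Sum>M=0..n. fps_nth (fps_polylog k) M * (fact n * fps_nth (?u ^ M) n))"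
    by (simp add: fps_compose_nth sum_distrib_left mult_ac)
  \<comment> \<open>The polylogarithm has no constant term, so \<open>M = 0\<close> drops
    out.\<close>
  also have "\<dots> = (\<Sum>M=1..n. fps_nth (fps_polylog k) M * (fact n * fps_nth (?u ^ M) n))"
    by (rule sum.mono_neutral_right) (auto simp: fps_polylog_def not_le)
  also have "\<dots> = (\<Sum>M=1..n. \<Sum>l\<le>n. ?T M l)"
    unfolding fps_nth_one_minus_degen_power_power[OF assms(2)] sum_distrib_left
    by (intro sum.cong refl) (simp add: fps_polylog_def)
  also have "\<dots> = (\<Sum>l\<le>n. \<Sum>M=1..n. ?T M l)"
    by (rule sum.swap)
  \<comment> \<open>The term \<open>l = 0\<close> vanishes because \<open>Stirling 0 M = 0\<close>
    for \<open>M \<ge> 1\<close>.\<close>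
  also have "\<dots> = (\<Sum>l=1..n. \<Sum>M=1..n. ?T M l)"
    by (rule sum.mono_neutral_right) (auto simp: not_le intro!: sum.neutral)
  also have "\<dots> = (\<Sum>l=1..n. \<Sum>m=0..l - 1.
      fact m * (- 1) ^ (l - m - 1) * lam ^ (n - l)
        * of_nat (Stirling l (m + 1)) * of_int (stirling_signed n l)
        / of_nat (m + 1) powi (k - 1))"
  proof (rule sum.cong)
    fix l assume l: "l \<in> {1..n}"
    \<comment> \<open>\<open>Stirling l M = 0\<close> for \<open>M > l\<close>; afterwards the index
      is shifted by \<open>M = m + 1\<close>.\<close>
    have "(\<Sum>M=1..n. ?T M l) = (\<Sum>M=1..l. ?T M l)"
      by (rule sum.mono_neutral_right) (use l in auto)
    also have "\<dots> = (\<Sum>m=0..l - 1. ?T (Suc m) l)"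
      using l by (subst sum.shift_bounds_cl_Suc_ivl[symmetric]) simp
    also have "\<dots> = (\<Sum>m=0..l - 1.
      fact m * (- 1) ^ (l - m - 1) * lam ^ (n - l)
        * of_nat (Stirling l (m + 1)) * of_int (stirling_signed n l)
        / of_nat (m + 1) powi (k - 1))"
    proof (rule sum.cong)
      fix m assume "m \<in> {0..l - 1}"
      \<comment> \<open>The exponents \<open>l + m + 1\<close> and \<open>l - m - 1\<close> have the
        same parity; \<open>m < l\<close> keeps the natural subtraction exact.\<close>
      then have "l + Suc m = 2 * Suc m + (l - m - 1)"
        using l by auto
      then have "(- 1) ^ (l + Suc m) = ((- 1) ^ (l - m - 1) :: complex)"
        by (simp only: power_add power_mult) simp
      \<comment> \<open>This turns \<open>(m+1)! / (m+1)^k\<close> into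
        \<open>m! / (m+1)^(k-1)\<close>.\<close>
      moreover have "(of_nat (m + 1) :: complex) powi (k - 1) = of_nat (m + 1) powi k / of_nat (m + 1)"
        by (subst power_int_diff) (simp_all del: of_nat_add of_nat_Suc)
      ultimately show "?T (Suc m) l = fact m * (- 1) ^ (l - m - 1) * lam ^ (n - l)
        * of_nat (Stirling l (m + 1)) * of_int (stirling_signed n l)
        / of_nat (m + 1) powi (k - 1)"
        by (simp add: mult_ac del: of_nat_Suc Stirling.simps)
    qed simp
    finally show "(\<Sum>M=1..n. ?T M l) = \<dots>" .
  qed simp
  finally show ?thesis
    unfolding degen_poly_bernoulli_diff_eq_polylog .
qed

end
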